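(* For fixed $n$, the small selective height of the set of all not strongly $n$-divisible words over an $l$-letter alphabet, with respect to the set $Z$ of non-cyclic words of length $2$, is greater than $$\Psi(n,l)=\frac{(l-2^{n-1})(n-2)(n-3)}{2}.$$
   Context: Words are over a finite alphabet $a_1<a_2<\dots<a_l$ and are compared lexicographically; two words are incomparable if one of them is a prefix of the other, and comparable otherwise. A word $u$ is non-cyclic if it is not of the form $v^k$ with an integer $k>1$. Two words are strongly comparable if any cyclic shift of the first is comparable with any cyclic shift of the second (for words of equal length: they are not cyclic shifts of each other). Subword means contiguous factor. Throughout the threshold is $k=2n$. Let $Z$ be a set of non-cyclic words of one fixed length. Strong $n$-divisibility (with respect to $Z$): a word $W$ is strongly $n$-divisible if $W=W_0W_1\cdots W_n$, where the subwords $W_1,\dots,W_n$ are in lexicographically decreasing order ($W_1>W_2>\dots>W_n$) and each $W_i$, $1\le i\le n$, begins with $z_i^{k}$ for some $z_i\in Z$, all the $z_i$ being distinct. Small selective height (with threshold $k$) of a word $W$ over $Z$: the maximal number $h$ such that $W$ contains $h$ pairwise disjoint subwords of the form $z^m$ with $z\in Z$, $m>k$, whose periods $z$ are pairwise not cyclic shifts of each other (i.e. they represent different classes of words up to cyclic shift). The small selective height of a set of words over $Z$ is the supremum of the small selective heights of its elements.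
   Formalization: Proved for n ≥ 2 and l ≥ 2: the claim fails for n = 1 (the height is 0 while Ψ(1,l) = l−1), for n = 0 with l ≥ 1, and for l = 1 with n = 2, 3 (Z is empty and Ψ = 0); one-letter and empty alphabets are excluded altogether. *)

theory Defs
  imports
    Complex_Main
    "HOL-Library.Sublist"
    "HOL-Library.Extended_Real"
begin

definition word_pow :: "'a list \<Rightarrow> nat \<Rightarrow> 'a list" where
  "word_pow z m = concat (replicate m z)"

definition non_cyclic :: "'a list \<Rightarrow> bool" where
  "non_cyclic u \<longleftrightarrow> \<not> (\<exists>v k. k > 1 \<and> u = word_pow v k)"

definition cyclic_shift :: "'a list \<Rightarrow> 'a list \<Rightarrow> bool" where
  "cyclic_shift u v \<longleftrightarrow> (\<exists>i. v = rotate i u)"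

(* The relation lexord puts a proper prefix below its extensions. Here such words are
   incomparable, so the order is cut down to parallel words, where neither is a prefix
   of the other. *)
definition word_less :: "'a::linorder list \<Rightarrow> 'a list \<Rightarrow> bool" where
  "word_less u v \<longleftrightarrow> u \<parallel> v \<and> (u, v) \<in> lexord {(a, b). a < b}"

(* Ws = [W_1, ..., W_n] and zs = [z_1, ..., z_n]; the threshold is k. *)
definition strongly_divisible :: "nat \<Rightarrow> nat \<Rightarrow> 'a::linorder list set \<Rightarrow> 'a list \<Rightarrow> bool" where
  "strongly_divisible k n Z W \<longleftrightarrow>
     (\<exists>W0 Ws zs. W = W0 @ concat Ws \<and> length Ws = n \<and>
        sorted_wrt (\<lambda>u v. word_less v u) Ws \<and>
        length zs = n \<and> distinct zs \<and> set zs \<subseteq> Z \<and>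
        (\<forall>i<n. prefix (word_pow (zs ! i) k) (Ws ! i)))"

(* Pairwise disjoint factors of W are listed from left to right: an entry (g, z, m) of bs
   stands for a gap g followed by the factor z^m, and r is what remains of W after the
   last factor. *)
definition has_selected_powers :: "nat \<Rightarrow> 'a list set \<Rightarrow> 'a list \<Rightarrow> nat \<Rightarrow> bool" where
  "has_selected_powers k Z W h \<longleftrightarrow>
     (\<exists>bs r. length bs = h \<and>
        W = concat (map (\<lambda>(g, z, m). g @ word_pow z m) bs) @ r \<and>
        (\<forall>(g, z, m) \<in> set bs. z \<in> Z \<and> m > k) \<and>
        sorted_wrt (\<lambda>(_, z, _) (_, z', _). \<not> cyclic_shift z z') bs)"

(* If [] is not in Z, then the numbers h are bounded by the length of W, and the supremum
   is their maximum. *)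
definition small_selective_height :: "nat \<Rightarrow> 'a list set \<Rightarrow> 'a list \<Rightarrow> enat" where
  "small_selective_height k Z W = (SUP h \<in> {h. has_selected_powers k Z W h}. enat h)"

definition small_selective_height_set :: "nat \<Rightarrow> 'a list set \<Rightarrow> 'a list set \<Rightarrow> enat" where
  "small_selective_height_set k Z S = (SUP W \<in> S. small_selective_height k Z W)"

definition non_cyclic_words :: "'a set \<Rightarrow> nat \<Rightarrow> 'a list set" where
  "non_cyclic_words A d = {z \<in> lists A. length z = d \<and> non_cyclic z}"

definition Psi :: "nat \<Rightarrow> nat \<Rightarrow> real" where
  "Psi n l = (real l - 2 ^ (n - 1)) * (real n - 2) * (real n - 3) / 2"

end

theory Submission
  imports Defs "HOL-Library.Product_Lexorder"
begin

text \<open>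
  Fix \<open>n - 1\<close> tokens and let the \<open>i\<close>-th token occupy at time \<open>t\<close> the letter with index
  \<open>t + 2 ^ i\<close>. The word is the product of the powers \<open>(x y)\<^sup>2\<^sup>n\<^sup>+\<^sup>1\<close>, where \<open>x < y\<close> are the letters
  occupied by two tokens at the same time; since a difference \<open>2 ^ j - 2 ^ i\<close> determines
  \<open>i < j\<close>, all these pairs are distinct. Colour the period \<open>x y\<close> with the token on \<open>x\<close> and the
  period \<open>y x\<close> with the token on \<open>y\<close>. Listing the pairs by time \<open>t\<close> and then lexicographically by
  \<open>(j, i)\<close> makes the periods of each colour increase strictly from left to right, so a decreasing
  sequence of periods uses each of the \<open>n - 1\<close> colours at most once. If \<open>\<Psi> \<le> 0\<close>, a single power
  suffices.
\<close>

section \<open>Concatenations of powers\<close>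

lemma length_concat_uniform:
  assumes "\<forall>xs\<in>set xss. length xs = L"
  shows "length (concat xss) = L * length xss"
  using assms by (induction xss) auto

lemma nth_concat_uniform:
  assumes "\<forall>xs\<in>set xss. length xs = L" and "q < L * length xss"
  shows "concat xss ! q = xss ! (q div L) ! (q mod L)"
  using assms
proof (induction xss arbitrary: q)
  case (Cons xs xss)
  show ?case
  proof (cases "q < L")
    case True
    then show ?thesis using Cons.prems by (simp add: nth_append)
  next
    case False
    then obtain q' where q: "q = L + q'" by (metis le_Suc_ex not_less)
    have L: "L > 0" using Cons.prems(2) by (cases "L = 0") auto
    have "concat xss ! q' = xss ! (q' div L) ! (q' mod L)"
      using Cons.prems q by (intro Cons.IH) auto
    then show ?thesis using L Cons.prems(1) by (simp add: q nth_append)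
  qed
qed simp

lemma length_word_pow [simp]: "length (word_pow z m) = m * length z"
  unfolding word_pow_def by (subst length_concat_uniform[of _ "length z"]) auto

lemma nth_word_pow:
  assumes "q < m * length z"
  shows "word_pow z m ! q = z ! (q mod length z)"
proof -
  have "q div length z < m"
    using assms by (simp add: less_mult_imp_div_less)
  then show ?thesis
    unfolding word_pow_def using assms
    by (subst nth_concat_uniform[of _ "length z"]) (auto simp: mult.commute)
qed

lemma set_word_pow_subset: "set (word_pow z m) \<subseteq> set z"
  by (auto simp: word_pow_def)

text \<open>Every block has the even length \<open>2 * m\<close>, so a position has the same parity
  in the whole word as inside its block.\<close>

lemma nth_concat_powers:
  assumes "q < 2 * m * length E"
  shows "concat (map (\<lambda>e. word_pow [x e, y e] m) E) ! q =
    (let e = E ! (q div (2 * m)) in if even q then x e else y e)"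
proof -
  let ?e = "E ! (q div (2 * m))"
  have m: "2 * m > 0" using assms by (cases "m = 0") auto
  have div: "q div (2 * m) < length E"
    using assms by (simp add: less_mult_imp_div_less mult.commute)
  have "concat (map (\<lambda>e. word_pow [x e, y e] m) E) ! q =
      map (\<lambda>e. word_pow [x e, y e] m) E ! (q div (2 * m)) ! (q mod (2 * m))"
    by (rule nth_concat_uniform) (use assms in auto)
  also have "\<dots> = word_pow [x ?e, y ?e] m ! (q mod (2 * m))"
    using div by simp
  also have "word_pow [x ?e, y ?e] m ! (q mod (2 * m)) =
      [x ?e, y ?e] ! (q mod (2 * m) mod length [x ?e, y ?e])"
    using mod_less_divisor[OF m, of q] by (intro nth_word_pow) simp
  also have "q mod (2 * m) mod length [x ?e, y ?e] = q mod 2"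
    by (simp add: mod_mod_cancel numeral_2_eq_2[symmetric])
  also have "[x ?e, y ?e] ! (q mod 2) = (let e = ?e in if even q then x e else y e)"
    by (simp add: mod2_eq_if Let_def)
  finally show ?thesis .
qed

text \<open>Blocks have at least two letters, so the second letter of the occurrence shares its
  block with its left or its right neighbour. Both neighbours carry the first letter of
  \<open>z\<close>, and \<open>k \<ge> 2\<close> ensures that the right one exists. Hence even an
  occurrence that crosses a block boundary has the pair of block \<open>f\<close> as its period, up
  to order.\<close>

lemma locate_period:
  assumes W: "concat (map (\<lambda>e. word_pow [x e, y e] m) E) = u @ word_pow z k @ r"
    and "length z = 2" "k \<ge> 2" "m > 0"
  defines "f \<equiv> (length u + 1) div (2 * m)"
  shows "f < length E \<and> z \<in> {[x (E ! f), y (E ! f)], [y (E ! f), x (E ! f)]}"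
proof -
  let ?W = "concat (map (\<lambda>e. word_pow [x e, y e] m) E)"
  obtain a b where z: "z = [a, b]"
    using \<open>length z = 2\<close> by (auto simp: numeral_2_eq_2 length_Suc_conv)
  have len: "length ?W = 2 * m * length E"
    by (subst length_concat_uniform[of _ "2 * m"]) auto
  have "length ?W \<ge> length u + 4"
    using \<open>k \<ge> 2\<close> by (simp add: W z)
  then have bound: "length u + 2 < 2 * m * length E" unfolding len by simp
  have letters: "?W ! (length u + i) = z ! (i mod 2)" if "i < 4" for i
    unfolding W using that \<open>k \<ge> 2\<close> by (simp add: nth_append nth_word_pow z numeral_2_eq_2)
  have a: "?W ! length u = a" and b: "?W ! (length u + 1) = b" and a': "?W ! (length u + 2) = a"
    using letters[of 0] letters[of 1] letters[of 2] by (simp_all add: z)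
  have "f < length E"
    unfolding f_def using bound by (simp add: less_mult_imp_div_less mult.commute)
  moreover have "z \<in> {[x (E ! f), y (E ! f)], [y (E ! f), x (E ! f)]}"
  \<comment> \<open>If the second letter of the occurrence opens block \<open>f\<close>, it is the
    \<open>x\<close> of that block and the next letter is its \<open>y\<close>, so \<open>z\<close>
    is read in reversed order. Otherwise the first two letters of the occurrence lie together in
    block \<open>f\<close>, and parity decides the order.\<close>
  proof (cases "(length u + 1) mod (2 * m) = 0")
    case True
    then have ev: "even (length u + 1)"
      by (metis dvd_mult_left dvd_eq_mod_eq_0)
    have "Suc (length u + 1) mod (2 * m) \<noteq> 0"
      using True \<open>m > 0\<close> by (simp only: mod_Suc) simp
    then have "(length u + 2) div (2 * m) = f"
      unfolding f_def using div_Suc[of "length u + 1" "2 * m"] by simp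
    then have "b = x (E ! f)" "a = y (E ! f)"
      using nth_concat_powers[of "length u + 1" m E x y] nth_concat_powers[of "length u + 2" m E x y]
        b a' ev bound by (simp_all add: Let_def f_def)
    then show ?thesis by (simp add: z)
  next
    case False
    then have "length u div (2 * m) = f"
      unfolding f_def using div_Suc[of "length u" "2 * m"] by simp
    then show ?thesis
      using nth_concat_powers[of "length u" m E x y] nth_concat_powers[of "length u + 1" m E x y]
        a b bound by (cases "even (length u)") (simp_all add: Let_def f_def z)
  qed
  ultimately show ?thesis by blast
qed

section \<open>Words that are not strongly divisible\<close>

lemma lexord_append_same_length:
  assumes "(u @ s, v @ t) \<in> lexord r" "length u = length v" "u \<noteq> v"
  shows "(u, v) \<in> lexord r"
  using assms(2,1,3) by (induction u v rule: list_induct2) auto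

text \<open>The periods are distinct and of equal length \<open>d\<close>, and each part begins with
  its period because \<open>k > 0\<close>. So the comparison of two parts is decided within their
  periods, and decreasing parts yield decreasing periods. The number \<open>p i\<close> is the
  position where the part \<open>Ws ! i\<close> starts.\<close>

lemma strongly_divisible_factor:
  assumes "strongly_divisible k n Z W" "\<forall>z\<in>Z. length z = d" "k > 0"
  obtains zs p where
    "\<And>i. i < n \<Longrightarrow> \<exists>u r. W = u @ word_pow (zs i) k @ r \<and> length u = p i"
    "\<And>i j. i < j \<Longrightarrow> j < n \<Longrightarrow> p i + k * d \<le> p j"
    "\<And>i. i < n \<Longrightarrow> zs i \<in> Z"
    "\<And>i j. i < j \<Longrightarrow> j < n \<Longrightarrow> zs i \<noteq> zs j"
    "\<And>i j. i < j \<Longrightarrow> j < n \<Longrightarrow> (zs j, zs i) \<in> lexord {(a, b). a < b}"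
proof -
  obtain W0 Ws zs where W: "W = W0 @ concat Ws" and lWs: "length Ws = n"
    and decr: "sorted_wrt (\<lambda>u v. word_less v u) Ws"
    and zs: "length zs = n" "distinct zs" "set zs \<subseteq> Z"
    and pre: "\<forall>i<n. prefix (word_pow (zs ! i) k) (Ws ! i)"
    using assms(1) unfolding strongly_divisible_def by blast
  define p where "p i = length (W0 @ concat (take i Ws))" for i
  have inZ: "zs ! i \<in> Z" if "i < n" for i using zs that by auto
  show thesis
  proof
    fix i assume i: "i < n"
    obtain s where s: "Ws ! i = word_pow (zs ! i) k @ s"
      using pre i by (auto elim: prefixE)
    have "Ws = take i Ws @ Ws ! i # drop (Suc i) Ws"
      using i lWs by (simp add: id_take_nth_drop)
    then have "concat Ws = concat (take i Ws) @ Ws ! i @ concat (drop (Suc i) Ws)"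
      by (metis concat.simps(2) concat_append)
    then show "\<exists>u r. W = u @ word_pow (zs ! i) k @ r \<and> length u = p i"
      by (intro exI[of _ "W0 @ concat (take i Ws)"] exI[of _ "s @ concat (drop (Suc i) Ws)"])
        (simp add: W s p_def)
    show "zs ! i \<in> Z" by (rule inZ[OF i])
  next
    fix i j assume ij: "i < j" "j < n"
    have "length (word_pow (zs ! i) k) \<le> length (Ws ! i)"
      using pre ij by (intro prefix_length_le) simp
    then have "k * d \<le> length (Ws ! i)"
      using inZ[of i] assms(2) ij by simp
    then have "p i + k * d \<le> p (Suc i)"
      using ij lWs by (simp add: p_def take_Suc_conv_app_nth)
    moreover have "take j Ws = take (Suc i) Ws @ take (j - Suc i) (drop (Suc i) Ws)"
      using ij by (simp add: take_add[symmetric])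
    then have "p (Suc i) \<le> p j" by (simp add: p_def)
    ultimately show "p i + k * d \<le> p j" by simp
    show ne: "zs ! i \<noteq> zs ! j" using zs ij by (simp add: nth_eq_iff_index_eq)
    have "word_less (Ws ! j) (Ws ! i)"
      using sorted_wrt_nth_less[OF decr ij(1)] ij lWs by simp
    then have lex: "(Ws ! j, Ws ! i) \<in> lexord {(a, b). a < b}" by (simp add: word_less_def)
    obtain s t where s: "Ws ! i = zs ! i @ s" and t: "Ws ! j = zs ! j @ t"
    proof -
      have "prefix (zs ! q) (Ws ! q)" if "q < n" for q
      proof -
        have "prefix (zs ! q) (word_pow (zs ! q) k)"
          using \<open>k > 0\<close> by (cases k) (auto simp: word_pow_def)
        then show ?thesis using pre that by (meson prefix_order.trans)
      qed
      then show thesis using that ij by (meson order.strict_trans prefixE)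
    qed
    have "length (zs ! j) = length (zs ! i)" using inZ assms(2) ij by simp
    then show "(zs ! j, zs ! i) \<in> lexord {(a, b). a < b}"
      using lexord_append_same_length[of "zs ! j" t "zs ! i" s] lex s t ne by auto
  qed
qed

text \<open>The \<open>n\<close> powers are disjoint and take \<open>k * d\<close> letters each.
  This rules out divisibility of words that are too short, such as a single power.\<close>

lemma strongly_divisible_length:
  assumes "strongly_divisible k n Z W" "\<forall>z\<in>Z. length z = d" "k > 0" "n > 0"
  shows "n * (k * d) \<le> length W"
proof -
  obtain zs p where occ: "\<And>i. i < n \<Longrightarrow> \<exists>u r. W = u @ word_pow (zs i) k @ r \<and> length u = p i"
    and gap: "\<And>i j. i < j \<Longrightarrow> j < n \<Longrightarrow> p i + k * d \<le> p j"
    and inZ: "\<And>i. i < n \<Longrightarrow> zs i \<in> Z"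
    by (rule strongly_divisible_factor[OF assms(1-3)]) (rule that; simp)
  have "i * (k * d) \<le> p i" if "i < n" for i
    using that
  proof (induction i)
    case (Suc i)
    then show ?case using gap[of i "Suc i"] by simp
  qed simp
  then have "(n - 1) * (k * d) \<le> p (n - 1)" using \<open>n > 0\<close> by simp
  moreover have "p (n - 1) + k * d \<le> length W"
    using occ[of "n - 1"] inZ[of "n - 1"] assms(2) \<open>n > 0\<close> by auto
  ultimately show ?thesis using \<open>n > 0\<close> by (cases n) auto
qed

text \<open>An occurrence located in a block may show its pair in either order, so both orders
  receive a colour.\<close>

definition coloured_periods :: "('e \<Rightarrow> 'a) \<Rightarrow> ('e \<Rightarrow> 'a) \<Rightarrow> ('e \<Rightarrow> 'c) \<Rightarrow> ('e \<Rightarrow> 'c) \<Rightarrow> 'e \<Rightarrow> ('a list \<times> 'c) set"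
  where "coloured_periods x y c d e = {([x e, y e], c e), ([y e, x e], d e)}"

lemma coloured_periods_same_colour:
  assumes "c e \<noteq> d e" "(z, q) \<in> coloured_periods x y c d e" "(z', q) \<in> coloured_periods x y c d e"
  shows "z = z'"
  using assms by (auto simp: coloured_periods_def)

text \<open>By the pigeonhole principle, two of the \<open>n\<close> decreasing periods share one of
  the \<open>N < n\<close> colours. In one block they would be equal, because the two orders have
  different colours; in different blocks the later one would be larger.\<close>

lemma not_strongly_divisible_coloured:
  fixes x y :: "'e \<Rightarrow> 'a::linorder" and c d :: "'e \<Rightarrow> nat"
  assumes col: "\<And>e. e \<in> set E \<Longrightarrow> c e \<noteq> d e \<and> c e < N \<and> d e < N"
    and incr: "sorted_wrt (\<lambda>e e'. \<forall>z z' q. (z, q) \<in> coloured_periods x y c d e \<longrightarrow>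
      (z', q) \<in> coloured_periods x y c d e' \<longrightarrow> (z, z') \<in> lexord {(a, b). a < b}) E"
    and "N < n" "k \<ge> 2" "m > 0" and Z: "\<forall>z\<in>Z. length z = 2"
  shows "\<not> strongly_divisible k n Z (concat (map (\<lambda>e. word_pow [x e, y e] m) E))"
    (is "\<not> strongly_divisible k n Z ?W")
proof
  assume sd: "strongly_divisible k n Z ?W"
  have "k > 0" using \<open>k \<ge> 2\<close> by simp
  obtain zs p
    where occ: "\<And>i. i < n \<Longrightarrow> \<exists>u r. ?W = u @ word_pow (zs i) k @ r \<and> length u = p i"
    and gap: "\<And>i j. i < j \<Longrightarrow> j < n \<Longrightarrow> p i + k * 2 \<le> p j"
    and inZ: "\<And>i. i < n \<Longrightarrow> zs i \<in> Z"
    and ne: "\<And>i j. i < j \<Longrightarrow> j < n \<Longrightarrow> zs i \<noteq> zs j"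
    and less: "\<And>i j. i < j \<Longrightarrow> j < n \<Longrightarrow> (zs j, zs i) \<in> lexord {(a, b). a < b}"
    by (rule strongly_divisible_factor[OF sd Z \<open>k > 0\<close>]) (rule that; simp)
  define f where "f i = (p i + 1) div (2 * m)" for i
  have place: "f i < length E \<and>
      zs i \<in> {[x (E ! f i), y (E ! f i)], [y (E ! f i), x (E ! f i)]}" if i: "i < n" for i
  proof -
    obtain u r where u: "?W = u @ word_pow (zs i) k @ r" "length u = p i"
      using occ[OF i] by blast
    show ?thesis
      using locate_period[OF u(1) _ \<open>k \<ge> 2\<close> \<open>m > 0\<close>] inZ[OF i] Z by (simp add: u(2) f_def)
  qed
  have "\<exists>q<N. (zs i, q) \<in> coloured_periods x y c d (E ! f i)" if "i < n" for i
    using place[OF that] col[of "E ! f i"] by (auto simp: coloured_periods_def)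
  then obtain g where g: "\<And>i. i < n \<Longrightarrow> g i < N"
      "\<And>i. i < n \<Longrightarrow> (zs i, g i) \<in> coloured_periods x y c d (E ! f i)"
    by metis
  have "g i \<noteq> g j" if ij: "i < j" "j < n" for i j
  proof
    assume eq: "g i = g j"
    have i: "i < n" using ij by simp
    \<comment> \<open>Occurrences run from left to right, so their block numbers cannot decrease;
      only equal or increasing blocks remain.\<close>
    have "f i \<le> f j" unfolding f_def using gap[OF ij] by (intro div_le_mono) simp
    then consider "f i = f j" | "f i < f j" by linarith
    then show False
    proof cases
      case 1
      then show False
        using coloured_periods_same_colour[of c "E ! f j" d] g(2)[OF i] g(2)[OF ij(2)] eq
          ne[OF ij] col[of "E ! f j"] place[OF ij(2)] by (metis nth_mem)
    next
      case 2
      have "(zs i, zs j) \<in> lexord {(a, b). a < b}"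
        using sorted_wrt_nth_less[OF incr 2] place[OF ij(2)] g(2)[OF i] g(2)[OF ij(2)] eq by metis
      moreover have "asym (lexord {(a, b::'a). a < b})"
        by (intro lexord_asym) (auto intro: asymI)
      ultimately show False using less[OF ij] by (meson asymD)
    qed
  qed
  then have "inj_on g {..<n}"
    by (intro inj_onI) (metis lessThan_iff linorder_neqE_nat)
  moreover have "g ` {..<n} \<subseteq> {..<N}" using g(1) by auto
  ultimately have "n \<le> N" using card_inj_on_le[of g "{..<n}" "{..<N}"] by simp
  then show False using \<open>N < n\<close> by simp
qed

section \<open>Selected powers\<close>

text \<open>A cyclic shift preserves the set of letters, so blocks with different letter sets have
  inequivalent periods. All gaps are taken empty.\<close>

lemma has_selected_powers_concat:
  assumes "distinct E" "inj_on (\<lambda>e. {x e, y e}) (set E)" "m > k"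
    and "\<And>e. e \<in> set E \<Longrightarrow> [x e, y e] \<in> Z"
  shows "has_selected_powers k Z (concat (map (\<lambda>e. word_pow [x e, y e] m) E)) (length E)"
  unfolding has_selected_powers_def
proof (intro exI conjI)
  let ?bs = "map (\<lambda>e. ([], [x e, y e], m)) E"
  have shift: "set u = set v" if "cyclic_shift u v" for u v :: "'b list"
    using that by (auto simp: cyclic_shift_def)
  show "length ?bs = length E" by simp
  show "concat (map (\<lambda>e. word_pow [x e, y e] m) E) =
      concat (map (\<lambda>(g, z, m). g @ word_pow z m) ?bs) @ []"
    by (simp add: o_def)
  show "\<forall>(g, z, m)\<in>set ?bs. z \<in> Z \<and> m > k" using assms(3,4) by auto
  have "\<not> cyclic_shift [x e, y e] [x e', y e']" if "e \<in> set E" "e' \<in> set E" "e \<noteq> e'" for e e'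
  proof
    assume "cyclic_shift [x e, y e] [x e', y e']"
    then have "{x e, y e} = {x e', y e'}" using shift by fastforce
    then show False using that inj_onD[OF assms(2)] by blast
  qed
  then show "sorted_wrt (\<lambda>(_, z, _) (_, z', _). \<not> cyclic_shift z z') ?bs"
    using assms(1) by (auto simp: sorted_wrt_iff_nth_less distinct_conv_nth)
qed

lemma small_selective_height_set_ge:
  assumes "W \<in> S" "has_selected_powers k Z W h"
  shows "enat h \<le> small_selective_height_set k Z S"
proof -
  have "enat h \<le> small_selective_height k Z W"
    unfolding small_selective_height_def using assms(2) by (intro SUP_upper) simp
  also have "\<dots> \<le> small_selective_height_set k Z S"
    unfolding small_selective_height_set_def using assms(1) by (intro SUP_upper)
  finally show ?thesis .
qed

lemma non_cyclic_pair:
  assumes "a \<noteq> b"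
  shows "non_cyclic [a, b]"
  unfolding non_cyclic_def
proof safe
  fix v and k :: nat
  assume k: "1 < k" and eq: "[a, b] = word_pow v k"
  have len: "k * length v = 2" using arg_cong[OF eq, of length] by simp
  \<comment> \<open>A root of length one has a single letter, which contradicts
    \<open>a \<noteq> b\<close>.\<close>
  have "length v = 1"
  proof -
    have "length v \<noteq> 0" using len by (intro notI) simp
    moreover have "\<not> length v \<ge> 2"
    proof
      assume "length v \<ge> 2"
      then have "k * length v \<ge> 2 * 2" using k by (intro mult_le_mono) auto
      then show False using len by simp
    qed
    ultimately show ?thesis by linarith
  qed
  then have "card (set v) \<le> 1" using card_length[of v] by simp
  moreover have "{a, b} \<subseteq> set v" using set_word_pow_subset[of v k] eq[symmetric] by simp
  then have "card {a, b} \<le> card (set v)" by (intro card_mono) auto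
  ultimately show False using assms by simp
qed

section \<open>The extremal word\<close>

text \<open>The equation is 2^j - 2^i = 2^j' - 2^i', written without truncated subtraction. If j <
  j', then j and i' are both at most j' - 1, so the left side is at most 2^j', which is less than
  the right side.\<close>

lemma power2_diff_inj:
  fixes i j i' j' :: nat
  assumes "i < j" "i' < j'" "(2::nat) ^ j + 2 ^ i' = 2 ^ j' + 2 ^ i"
  shows "i = i' \<and> j = j'"
proof -
  have *: False if "i < j" "i' < j'" "(2::nat) ^ j + 2 ^ i' = 2 ^ j' + 2 ^ i" and less: "j < j'" for i j i' j' :: nat
  proof -
    obtain q where q: "j' = Suc q" using less by (cases j') auto
    have "(2::nat) ^ j \<le> 2 ^ q" "(2::nat) ^ i' \<le> 2 ^ q"
      using that q by (auto intro!: power_increasing)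
    then have "(2::nat) ^ j + 2 ^ i' \<le> 2 * 2 ^ q" by linarith
    then have "(2::nat) ^ j + 2 ^ i' \<le> 2 ^ j'" by (simp add: q)
    moreover have "(2::nat) ^ i > 0" by simp
    ultimately show False using that(3) by linarith
  qed
  have "j = j'" using *[OF assms] *[OF assms(2,1) assms(3)[symmetric]]
    by (cases j j' rule: linorder_cases) auto
  then show ?thesis using assms(3) by simp
qed

lemma obtain_enumeration:
  fixes A :: "'a::linorder set"
  assumes "finite A" "card A = l"
  obtains a :: "nat \<Rightarrow> 'a" where "\<And>i. i < l \<Longrightarrow> a i \<in> A" "\<And>i j. i < j \<Longrightarrow> j < l \<Longrightarrow> a i < a j"
proof
  let ?s = "sorted_list_of_set A"
  have len: "length ?s = l" using assms by simp
  show "?s ! i \<in> A" if "i < l" for i using that assms len nth_mem[of i ?s] by simp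
  show "?s ! i < ?s ! j" if "i < j" "j < l" for i j
    using that len strict_sorted_list_of_set[of A] by (auto intro: sorted_wrt_nth_less)
qed

lemma height_lower_bound:
  fixes A :: "'a::linorder set"
  assumes A: "finite A" "card A = l" and "N < n" "k \<ge> 2"
  shows "enat ((l - 2 ^ (N - 1)) * (\<Sum>j<N. j)) \<le>
    small_selective_height_set k (non_cyclic_words A 2)
      {W \<in> lists A. \<not> strongly_divisible k n (non_cyclic_words A 2) W}"
proof -
  obtain a where aA: "\<And>i. i < l \<Longrightarrow> a i \<in> A" and a_less: "\<And>i j. i < j \<Longrightarrow> j < l \<Longrightarrow> a i < a j"
    using obtain_enumeration[OF A] by blast
  \<comment> \<open>The bound on the time \<open>t\<close> keeps the last token, at index
    \<open>t + 2 ^ (N - 1)\<close>, inside the alphabet. The components are ordered as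
    \<open>(t, j, i)\<close> with \<open>i < j\<close>, so that the product order on triples is the
    desired order of the blocks.\<close>
  define I where "I = {..<l - 2 ^ (N - 1)} \<times> (SIGMA j:{..<N}. {..<j})"
  define E where "E = sorted_list_of_set I"
  define x y where "x = (\<lambda>(t :: nat, j :: nat, i :: nat). a (t + 2 ^ i))"
    and "y = (\<lambda>(t :: nat, j :: nat, i :: nat). a (t + 2 ^ j))"
  define c d where "c = (\<lambda>(t :: nat, j :: nat, i :: nat). i)"
    and "d = (\<lambda>(t :: nat, j :: nat, i :: nat). j)"
  \<comment> \<open>The exponent \<open>Suc k\<close> is the least one above the threshold.\<close>
  let ?W = "concat (map (\<lambda>e. word_pow [x e, y e] (Suc k)) E)"
  let ?Z = "non_cyclic_words A 2"
  have "finite I" by (simp add: I_def)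
  then have E: "set E = I" "distinct E" "sorted_wrt (<) E" "length E = card I"
    by (simp_all add: E_def)
  have card_I: "card I = (l - 2 ^ (N - 1)) * (\<Sum>j<N. j)"
    by (simp add: I_def card_cartesian_product)
  have in_range: "t + 2 ^ i < l" if "t < l - 2 ^ (N - 1)" "i < N" for t i :: nat
  proof -
    have "(2::nat) ^ i \<le> 2 ^ (N - 1)" using that by (intro power_increasing) auto
    then show ?thesis using that by linarith
  qed
  have a_inj: "i = j" if "a i = a j" "i < l" "j < l" for i j
    using a_less that by (metis less_irrefl linorder_neqE_nat)
  have xy: "x e \<in> A" "y e \<in> A" "x e < y e" if "e \<in> I" for e
    using that by (auto simp: I_def x_def y_def intro!: aA a_less in_range)
  have inZ: "[x e, y e] \<in> ?Z" if "e \<in> I" for e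
    using xy[OF that] by (auto simp: non_cyclic_words_def intro: non_cyclic_pair)
  have "inj_on (\<lambda>e. {x e, y e}) I"
  proof (rule inj_onI)
    fix e e' assume e: "e \<in> I" "e' \<in> I" and eq: "{x e, y e} = {x e', y e'}"
    have xy_eq: "x e = x e'" "y e = y e'"
      using eq xy(3)[OF e(1)] xy(3)[OF e(2)] by (auto simp: doubleton_eq_iff)
    obtain t j i t' j' i' where [simp]: "e = (t, j, i)" "e' = (t', j', i')"
      by (metis prod_cases3)
    have ind: "t < l - 2 ^ (N - 1)" "j < N" "i < j" "t' < l - 2 ^ (N - 1)" "j' < N" "i' < j'"
      using e by (auto simp: I_def)
    \<comment> \<open>Eliminating the times leaves an equality of differences of powers of two. It
      determines the tokens, and these determine the time.\<close>
    have "t + 2 ^ i = t' + 2 ^ i'" "t + 2 ^ j = t' + 2 ^ j'"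
      using xy_eq ind by (auto simp: x_def y_def intro!: a_inj in_range)
    then show "e = e'" using power2_diff_inj[of i j i' j'] ind by simp
  qed
  then have selected: "has_selected_powers k ?Z ?W (length E)"
    using E inZ by (intro has_selected_powers_concat) auto
  have "sorted_wrt (\<lambda>e e'. \<forall>z z' q. (z, q) \<in> coloured_periods x y c d e \<longrightarrow>
      (z', q) \<in> coloured_periods x y c d e' \<longrightarrow> (z, z') \<in> lexord {(a, b). a < b}) E"
  proof (rule sorted_wrt_mono_rel[OF _ E(3)], intro allI impI)
    fix e e' z z' q
    assume e: "e \<in> set E" "e' \<in> set E" and less: "e < e'"
      and z: "(z, q) \<in> coloured_periods x y c d e" "(z', q) \<in> coloured_periods x y c d e'"
    obtain t j i t' j' i' where [simp]: "e = (t, j, i)" "e' = (t', j', i')"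
      by (metis prod_cases3)
    have ind: "t < l - 2 ^ (N - 1)" "j < N" "i < j" "t' < l - 2 ^ (N - 1)" "j' < N" "i' < j'"
      using e by (auto simp: I_def E)
    have mono: "a (s + 2 ^ p) < a (s' + 2 ^ p')"
      if "s \<le> s'" "p \<le> p'" "s \<noteq> s' \<or> p \<noteq> p'" "s' < l - 2 ^ (N - 1)" "p' < N" for s s' p p' :: nat
    proof (intro a_less in_range that)
      have "(2::nat) ^ p \<le> 2 ^ p'" using that by (intro power_increasing) auto
      moreover have "p \<noteq> p' \<Longrightarrow> (2::nat) ^ p < 2 ^ p'"
        using that by (intro power_strict_increasing) auto
      ultimately show "s + 2 ^ p < s' + 2 ^ p'"
        using that by (cases "p = p'") (auto intro: add_le_less_mono)
    qed
    show "(z, z') \<in> lexord {(a, b). a < b}"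
    proof -
      have order: "t < t' \<or> t = t' \<and> (j < j' \<or> j = j' \<and> i < i')"
        using less by (simp add: less_prod_def')
      have z_cases: "z = [a (t + 2 ^ i), a (t + 2 ^ j)] \<and> q = i \<or>
          z = [a (t + 2 ^ j), a (t + 2 ^ i)] \<and> q = j"
        using z(1) by (auto simp: coloured_periods_def x_def y_def c_def d_def)
      have z'_cases: "z' = [a (t' + 2 ^ i'), a (t' + 2 ^ j')] \<and> q = i' \<or>
          z' = [a (t' + 2 ^ j'), a (t' + 2 ^ i')] \<and> q = j'"
        using z(2) by (auto simp: coloured_periods_def x_def y_def c_def d_def)
      \<comment> \<open>A period of colour \<open>q\<close> starts with the letter of token
        \<open>q\<close>; let \<open>p\<close> and \<open>p'\<close> be the partner tokens. At a
        fixed time, the order by \<open>(j, i)\<close> lists the blocks \<open>(q, p)\<close> with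
        \<open>p < q\<close> first and then the blocks \<open>(p, q)\<close> with
        \<open>p > q\<close>, each group with increasing \<open>p\<close>. Hence the partner
        grows.\<close>
      obtain p p' where p: "z = [a (t + 2 ^ q), a (t + 2 ^ p)]"
          "z' = [a (t' + 2 ^ q), a (t' + 2 ^ p')]"
          "q < N" "p' < N" "t = t' \<Longrightarrow> p < p'"
        using z_cases z'_cases ind order by (elim disjE conjE) auto
      show ?thesis
      proof (cases "t < t'")
        case True
        then have "a (t + 2 ^ q) < a (t' + 2 ^ q)" using ind p by (intro mono) auto
        then show ?thesis by (simp add: p)
      next
        case False
        then have "t = t'" using order by simp
        then have "a (t + 2 ^ p) < a (t' + 2 ^ p')" using ind p by (intro mono) auto
        then show ?thesis by (simp add: p \<open>t = t'\<close>)
      qed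
    qed
  qed
  then have "\<not> strongly_divisible k n ?Z ?W"
    using \<open>N < n\<close> \<open>k \<ge> 2\<close>
    by (intro not_strongly_divisible_coloured[where N = N])
      (auto simp: E I_def c_def d_def non_cyclic_words_def)
  moreover have "?W \<in> lists A"
    using xy E set_word_pow_subset by fastforce
  ultimately show ?thesis
    using small_selective_height_set_ge[OF _ selected] E(4) card_I by simp
qed

text \<open>A single power of exponent \<open>Suc k\<close> has length 2k + 2, less than the 4k
  letters that even two divisible parts would require. It serves for the parameters where
  \<open>Psi\<close> is at most 0.\<close>

lemma height_pos:
  fixes A :: "'a::linorder set"
  assumes "finite A" "card A \<ge> 2" "n \<ge> 2" "k \<ge> 2"
  shows "enat 1 \<le> small_selective_height_set k (non_cyclic_words A 2)
      {W \<in> lists A. \<not> strongly_divisible k n (non_cyclic_words A 2) W}"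
proof -
  let ?Z = "non_cyclic_words A 2"
  obtain s :: "nat \<Rightarrow> 'a" where s: "\<And>i. i < card A \<Longrightarrow> s i \<in> A"
      "\<And>i j. i < j \<Longrightarrow> j < card A \<Longrightarrow> s i < s j"
    using obtain_enumeration[OF assms(1) refl] by blast
  have ab: "s 0 \<in> A" "s 1 \<in> A" "s 0 \<noteq> s 1"
    using s(1)[of 0] s(1)[of 1] s(2)[of 0 1] assms(2) by auto
  let ?W = "word_pow [s 0, s 1] (Suc k)"
  have "[s 0, s 1] \<in> ?Z" using ab by (simp add: non_cyclic_words_def non_cyclic_pair)
  then have "has_selected_powers k ?Z ?W 1"
    using has_selected_powers_concat[of "[()]" "\<lambda>_. s 0" "\<lambda>_. s 1" k "Suc k" ?Z] by simp
  moreover have "\<not> strongly_divisible k n ?Z ?W"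
  proof
    assume "strongly_divisible k n ?Z ?W"
    moreover have "\<forall>z\<in>?Z. length z = 2" by (simp add: non_cyclic_words_def)
    moreover have "k > 0" "n > 0" using assms by auto
    ultimately have "n * (k * 2) \<le> length ?W" by (rule strongly_divisible_length)
    then have "n * (k * 2) \<le> 2 * k + 2" by simp
    moreover have "2 * (k * 2) \<le> n * (k * 2)" using assms by (intro mult_le_mono1)
    ultimately show False using \<open>k \<ge> 2\<close> by linarith
  qed
  moreover have "?W \<in> lists A" using set_word_pow_subset ab by fastforce
  ultimately show ?thesis by (intro small_selective_height_set_ge) auto
qed

section \<open>Comparison of the lower bounds with \<open>Psi\<close>\<close>

theorem mainTheorem2:
  fixes A :: "'a::linorder set" and n l :: nat
  assumes "finite A" and "card A = l" and "l \<ge> 2" and "n \<ge> 2"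
  shows "ereal (Psi n l) <
    ereal_of_enat (small_selective_height_set (2 * n) (non_cyclic_words A 2)
      {W \<in> lists A. \<not> strongly_divisible (2 * n) n (non_cyclic_words A 2) W})"
    (is "_ < ereal_of_enat ?H")
proof -
  \<comment> \<open>The type of the height allows infinity, so a finite number is placed between
    \<open>Psi\<close> and the height.\<close>
  have "\<exists>h. Psi n l < real h \<and> enat h \<le> ?H"
  proof (cases "n \<ge> 3 \<and> l > 2 ^ (n - 1)")
    case True
    then obtain s where s: "n = s + 3" by (metis add.commute le_Suc_ex)
    \<comment> \<open>With n - 1 tokens this is (l - 2^(n-2)) (n-1)(n-2)/2, which exceeds
      \<open>Psi\<close> in both factors: the subtracted power is halved, and (n-2)(n-3)/2 grows by
      n - 2.\<close>
    define h where "h = (l - 2 ^ (n - 1 - 1)) * (\<Sum>j<n - 1. j)"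
    have "enat h \<le> ?H"
      unfolding h_def using assms by (intro height_lower_bound) auto
    moreover have "Psi n l < real h"
    proof -
      have sum: "(\<Sum>j<Suc r. real j) = real r * (real r + 1) / 2" for r
        by (induction r) (auto simp: field_simps)
      have "2 ^ (s + 2) < l" using True s by simp
      moreover have "(2::nat) ^ (s + 1) \<le> 2 ^ (s + 2)" by simp
      ultimately have "2 ^ (s + 1) \<le> l" by linarith
      then have l: "real (l - 2 ^ (s + 1)) = real l - 2 ^ (s + 1)" by (simp add: of_nat_diff)
      have n: "n - 1 = Suc (s + 1)" "Suc (s + 1) - 1 = s + 1" by (simp_all add: s)
      have h: "real h = (real l - 2 ^ (s + 1)) * (real (s + 1) * (real (s + 1) + 1) / 2)"
        unfolding h_def n of_nat_mult of_nat_sum l sum ..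
      have P: "Psi n l = (real l - 2 ^ (s + 2)) * ((real s + 1) * real s / 2)"
        by (simp add: Psi_def s)
      have "real (2 ^ (s + 2)) < real l"
        using \<open>2 ^ (s + 2) < l\<close> by (simp only: of_nat_less_iff)
      then have pos: "0 < real l - 2 ^ (s + 2)" by simp
      have less: "real l - 2 ^ (s + 2) < real l - 2 ^ (s + 1)" by simp
      have "real (s + 1) * (real (s + 1) + 1) / 2 = (real s + 1) * real s / 2 + (real s + 1)"
        by (simp add: field_simps)
      then have "(real s + 1) * real s / 2 < real (s + 1) * (real (s + 1) + 1) / 2" by linarith
      with less show ?thesis
        unfolding h P by (rule mult_strict_mono) (use pos less in \<open>linarith, simp\<close>)
    qed
    ultimately show ?thesis by blast
  next
    case False
    \<comment> \<open>For n = 2 the factor n - 2 vanishes; for n at least 3 the failing condition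
      makes the first factor nonpositive and leaves the others nonnegative.\<close>
    have "Psi n l \<le> 0"
    proof (cases "n = 2")
      case False
      with \<open>\<not> (n \<ge> 3 \<and> l > 2 ^ (n - 1))\<close> \<open>n \<ge> 2\<close> have "n \<ge> 3" "real l \<le> real (2 ^ (n - 1))"
        by (auto simp only: of_nat_le_iff)
      then show ?thesis
        unfolding Psi_def by (auto intro!: mult_nonpos_nonneg divide_nonpos_nonneg)
    qed (simp add: Psi_def)
    moreover have "enat 1 \<le> ?H" using assms by (intro height_pos) auto
    ultimately show ?thesis by (intro exI[of _ 1]) auto
  qed
  then obtain h where "Psi n l < real h" "enat h \<le> ?H" by blast
  then have "ereal (Psi n l) < ereal_of_enat (enat h)" by simp
  also have "\<dots> \<le> ereal_of_enat ?H" using \<open>enat h \<le> ?H\<close> by (simp only: ereal_of_enat_le_iff)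
  finally show ?thesis .
qed

end
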